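(* Let $Y\in\mathbb{R}^{n\times p}$, $f(x)=\|Y^\top x\|_1$, and $\mathcal{M}=\{x\in\mathbb{R}^n : \|x\|_2=1\}$. Suppose that $\mathcal{X}\subseteq\mathcal{M}$ is a set of weak sharp minima for $f$ with parameters $(\alpha,\delta)$, where $\alpha,\delta>0$. Let $\overline{\delta}=\min\{\delta,\alpha/L\}$, and let $\{x^k\}_{k\ge0}$ be the sequence generated by the ManPPA algorithm (described in the context) with an initial point $x^0\in\mathcal{M}$ satisfying $\mathrm{dist}(x^0,\mathcal{X})<\overline{\delta}$ and with proximal parameter $t>0$ satisfying $$t\le\min\left\{\frac{\overline{\delta}}{2\alpha-L\overline{\delta}},\ \frac{2\overline{\delta}\alpha-L\overline{\delta}^2}{L^2}\right\}.$$ Then $$\mathrm{dist}(x^k,\mathcal{X})\le\overline{\delta}\quad\text{for all }k\ge0,$$ and $$\mathrm{dist}(x^{k+1},\mathcal{X})\le \mathcal{O}\big(\mathrm{dist}^2(x^k,\mathcal{X})\big)\quad\text{for all }k\ge0,$$ i.e., there is a constant $C>0$ independent of $k$ such that $\mathrm{dist}(x^{k+1},\mathcal{X})\le C\,\mathrm{dist}^2(x^k,\mathcal{X})$ for all $k\ge0$.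
   Context: $L>0$ denotes the Lipschitz constant of $f$, i.e., $|f(x)-f(y)|\le L\|x-y\|_2$ for all $x,y\in\mathbb{R}^n$. $\mathrm{dist}(x,\mathcal{X})=\inf_{y\in\mathcal{X}}\|y-x\|_2$. $\mathrm{Proj}_{\mathcal{M}}$ denotes projection onto $\mathcal{M}$, so $\mathrm{Proj}_{\mathcal{M}}(x)=x/\|x\|_2$ for $x\ne0$. Weak sharp minima: a (nonempty) set $\mathcal{X}\subseteq\mathcal{M}$ is a set of weak sharp minima for $f$ with parameters $(\alpha,\delta)$, $\alpha,\delta>0$, if for every $x\in\mathcal{M}$ with $\mathrm{dist}(x,\mathcal{X})\le\delta$ one has $f(x)-f(\bar x)\ge\alpha\cdot\mathrm{dist}(x,\mathcal{X})$ for all $\bar x\in\mathcal{X}$. ManPPA algorithm. Input: $x^0\in\mathcal{M}$, $\beta\in(0,1)$, $t>0$. For $k=0,1,2,\dots$: (1) let $d^k$ be the unique solution of $$\min_{d\in\mathbb{R}^n}\ \|Y^\top(x^k+d)\|_1+\frac{1}{2t}\|d\|_2^2\quad\text{s.t.}\quad d^\top x^k=0;$$ (2) let $j_k$ be the smallest nonnegative integer such that $f(\mathrm{Proj}_{\mathcal{M}}(x^k+\beta^{j_k}d^k))\le f(x^k)-\frac{\beta^{j_k}}{2t}\|d^k\|_2^2$; (3) set $\alpha_k=\beta^{j_k}$ and $x^{k+1}=\mathrm{Proj}_{\mathcal{M}}(x^k+\alpha_k d^k)$. *)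

theory Defs
  imports "HOL-Analysis.Analysis"
begin

definition l1_norm :: "real^'p \<Rightarrow> real" where
  "l1_norm v = (\<Sum>i\<in>UNIV. \<bar>v $ i\<bar>)"

text \<open>A matrix with n rows and p columns has type \<^typ>\<open>real^'p^'n\<close>.\<close>

definition l1_objective :: "real^'p^'n \<Rightarrow> real^'n \<Rightarrow> real" where
  "l1_objective Y x = l1_norm (transpose Y *v x)"

definition weak_sharp_minima ::
    "('a::euclidean_space \<Rightarrow> real) \<Rightarrow> real \<Rightarrow> real \<Rightarrow> 'a set \<Rightarrow> bool" where
  "weak_sharp_minima f \<alpha> \<delta> X \<longleftrightarrow>
     X \<noteq> {} \<and> X \<subseteq> sphere 0 1 \<and> 0 < \<alpha> \<and> 0 < \<delta> \<and>
     (\<forall>x\<in>sphere 0 1. infdist x X \<le> \<delta> \<longrightarrow>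
        (\<forall>xbar\<in>X. f x - f xbar \<ge> \<alpha> * infdist x X))"

definition proj_sphere :: "'a::euclidean_space \<Rightarrow> 'a" where
  "proj_sphere = closest_point (sphere 0 1)"

definition manppa_direction :: "real^'p^'n \<Rightarrow> real \<Rightarrow> real^'n \<Rightarrow> real^'n \<Rightarrow> bool" where
  "manppa_direction Y t x d \<longleftrightarrow>
     is_arg_min (\<lambda>d. l1_norm (transpose Y *v (x + d)) + 1 / (2 * t) * (norm d)\<^sup>2)
       (\<lambda>d. d \<bullet> x = 0) d"

definition manppa_accept ::
    "real^'p^'n \<Rightarrow> real \<Rightarrow> real \<Rightarrow> real^'n \<Rightarrow> real^'n \<Rightarrow> nat \<Rightarrow> bool" where
  "manppa_accept Y \<beta> t x d j \<longleftrightarrow>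
     l1_objective Y (proj_sphere (x + \<beta> ^ j *\<^sub>R d))
       \<le> l1_objective Y x - \<beta> ^ j / (2 * t) * (norm d)\<^sup>2"

text \<open>The algorithm is given as a relation: for a unit vector \<open>x\<close>, \<open>t > 0\<close> and
  \<open>0 < \<beta> < 1\<close> the subproblem is strongly convex on a subspace and the line search
  terminates, so each step has exactly one outcome.\<close>

definition manppa_step :: "real^'p^'n \<Rightarrow> real \<Rightarrow> real \<Rightarrow> real^'n \<Rightarrow> real^'n \<Rightarrow> bool" where
  "manppa_step Y \<beta> t x x' \<longleftrightarrow>
     (\<exists>d j. manppa_direction Y t x d \<and>
            manppa_accept Y \<beta> t x d j \<and> (\<forall>i<j. \<not> manppa_accept Y \<beta> t x d i) \<and>
            x' = proj_sphere (x + \<beta> ^ j *\<^sub>R d))"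

definition manppa_sequence :: "real^'p^'n \<Rightarrow> real \<Rightarrow> real \<Rightarrow> (nat \<Rightarrow> real^'n) \<Rightarrow> bool" where
  "manppa_sequence Y \<beta> t x \<longleftrightarrow> (\<forall>k. manppa_step Y \<beta> t (x k) (x (Suc k)))"

end

theory Submission
  imports Defs
begin

text \<open>Since \<open>f\<close> is convex and positively homogeneous and tangent steps leave the unit ball,
  the line search always accepts the unit step, so \<open>x\<^sup>+\<close> is the normalisation of \<open>y = x + d\<close>.
  Let \<open>z\<close> be a nearest point of the closure of \<open>X\<close>, \<open>r = \<parallel>x - z\<parallel>\<close>, and compare \<open>d\<close> with
  the tangential part \<open>e\<close> of \<open>z - x\<close>: here \<open>x + e = z + (r\<^sup>2/2) x\<close>, so that
  \<open>f (x + e) \<le> f z + L r\<^sup>2/2\<close>. The proximal inequality at \<open>e\<close> gives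
  \<open>f y - f z \<le> (L + 1/t) r\<^sup>2/2\<close>, which with sharpness is the quadratic rate. Together with
  sharpness at \<open>x\<close> it also gives
  \<open>\<parallel>x\<^sup>+ - z\<parallel>\<^sup>2 \<le> (1 + t L) r\<^sup>2 - 2 t \<alpha> r + t\<^sup>2 L\<^sup>2\<close>; the right-hand side is convex in \<open>r\<close>,
  and the two bounds on \<open>t\<close> make it at most \<open>\<delta>bar\<^sup>2\<close> at the end points \<open>0\<close> and \<open>\<delta>bar\<close>.\<close>

section \<open>The objective as a seminorm\<close>

lemma l1_objective_scaleR: "l1_objective Y (c *\<^sub>R x) = \<bar>c\<bar> * l1_objective Y x"
  by (simp add: l1_objective_def l1_norm_def matrix_vector_mult_scaleR abs_mult sum_distrib_left)

lemma l1_objective_nonneg: "0 \<le> l1_objective Y x"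
  by (simp add: l1_objective_def l1_norm_def sum_nonneg)

lemma l1_objective_triangle: "l1_objective Y (x + y) \<le> l1_objective Y x + l1_objective Y y"
  by (simp add: l1_objective_def l1_norm_def matrix_vector_right_distrib
      sum.distrib [symmetric] sum_mono)

lemma convex_on_l1_objective: "convex_on UNIV (l1_objective Y)"
proof (rule convex_onI)
  fix s :: real and x y
  assume "0 < s" "s < 1"
  then show "l1_objective Y ((1 - s) *\<^sub>R x + s *\<^sub>R y)
      \<le> (1 - s) * l1_objective Y x + s * l1_objective Y y"
    using l1_objective_triangle [of Y "(1 - s) *\<^sub>R x" "s *\<^sub>R y"]
    by (simp add: l1_objective_scaleR)
qed simp

section \<open>Projection onto the unit sphere\<close>

lemma proj_sphere_in_sphere: "proj_sphere (y :: 'a::euclidean_space) \<in> sphere 0 1"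
  unfolding proj_sphere_def by (intro closest_point_in_set) auto

text \<open>\<open>closest_point\<close> is a choice, so uniqueness must be shown. Comparing its
  value \<open>p\<close> with the candidate \<open>y /\<^sub>R norm y\<close> and expanding squares
  gives \<open>norm y \<le> y \<bullet> p\<close>, the equality case of Cauchy-Schwarz.\<close>

lemma proj_sphere_eq_normalize:
  fixes y :: "'a::euclidean_space"
  assumes "y \<noteq> 0"
  shows "proj_sphere y = y /\<^sub>R norm y"
proof -
  define p where "p = proj_sphere y"
  have p: "norm p = 1"
    using proj_sphere_in_sphere [of y] by (simp add: p_def)
  have "dist y p \<le> dist y (y /\<^sub>R norm y)"
    unfolding p_def proj_sphere_def using assms by (intro closest_point_le) auto
  also have "\<dots> = \<bar>norm y - 1\<bar>"
  proof -
    have "y - y /\<^sub>R norm y = ((norm y - 1) / norm y) *\<^sub>R y"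
      using assms by (simp add: diff_divide_distrib scaleR_left_diff_distrib inverse_eq_divide)
    then show ?thesis
      using assms by (simp add: dist_norm)
  qed
  finally have "(norm (y - p))\<^sup>2 \<le> (norm y - 1)\<^sup>2"
    using abs_le_square_iff [of "norm (y - p)" "norm y - 1"] by (simp add: dist_norm)
  moreover have "(norm (y - p))\<^sup>2 = (norm y)\<^sup>2 - 2 * (y \<bullet> p) + 1"
    using p by (simp add: dot_norm_neg field_simps)
  moreover have "(norm y - 1)\<^sup>2 = (norm y)\<^sup>2 - 2 * norm y + 1"
    by (simp add: power2_diff)
  ultimately have "norm y \<le> y \<bullet> p"
    by linarith
  then have "y \<bullet> p = norm y * norm p"
    using norm_cauchy_schwarz [of y p] p by simp
  then have y: "norm y *\<^sub>R p = y"
    using p norm_cauchy_schwarz_eq [of y p] by simp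
  have "y /\<^sub>R norm y = (norm y *\<^sub>R p) /\<^sub>R norm y"
    unfolding y ..
  also have "\<dots> = p"
    using assms by simp
  finally show ?thesis
    by (simp add: p_def)
qed

text \<open>With \<open>y = s *\<^sub>R u\<close> and \<open>u\<close> a unit vector, the two
  squared distances to \<open>z\<close> differ by
  \<open>(s - 1) * (s + 1 - 2 * (u \<bullet> z))\<close>; both factors are nonnegative as
  \<open>s\<close> is at least 1 and \<open>u \<bullet> z\<close> at most 1.\<close>

lemma norm_proj_sphere_diff_le:
  fixes y z :: "'a::euclidean_space"
  assumes "1 \<le> norm y" "norm z = 1"
  shows "norm (proj_sphere y - z) \<le> norm (y - z)"
proof -
  define s u where "s = norm y" and "u = y /\<^sub>R norm y"
  have "y \<noteq> 0"
    using assms by auto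
  then have u: "norm u = 1" "y = s *\<^sub>R u"
    by (simp_all add: u_def s_def)
  have "0 \<le> (s - 1) * (s + 1 - 2 * (u \<bullet> z))"
    using norm_cauchy_schwarz [of u z] u assms by (intro mult_nonneg_nonneg) (auto simp: s_def)
  also have "\<dots> = (norm (y - z))\<^sup>2 - (norm (u - z))\<^sup>2"
    using u(1) assms(2) unfolding u(2) norm_eq_1
    by (simp add: power2_norm_eq_inner inner_diff inner_commute algebra_simps)
  finally have "norm (u - z) \<le> norm (y - z)"
    by (simp add: norm_le power2_norm_eq_inner)
  then show ?thesis
    using proj_sphere_eq_normalize [OF \<open>y \<noteq> 0\<close>] by (simp add: u_def)
qed

lemma l1_objective_proj_sphere_le:
  assumes "1 \<le> norm y"
  shows "l1_objective Y (proj_sphere y) \<le> l1_objective Y y"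
proof -
  have "y \<noteq> 0"
    using assms by auto
  then have "l1_objective Y (proj_sphere y) = l1_objective Y y / norm y"
    by (simp add: proj_sphere_eq_normalize l1_objective_scaleR divide_inverse mult.commute)
  also have "\<dots> \<le> l1_objective Y y"
    using \<open>y \<noteq> 0\<close> mult_left_mono [OF assms l1_objective_nonneg [of Y y]]
    by (simp add: pos_divide_le_eq)
  finally show ?thesis .
qed

section \<open>Passing to the closure\<close>

lemma infdist_closure: "infdist x (closure X) = infdist x X"
  by (simp add: infdist_eq_setdist)

text \<open>\<open>X\<close> need not be closed, so a nearest point may exist only in its closure.
  For fixed \<open>x\<close> the sharpness inequality is a closed condition on \<open>z\<close>, and
  the distance to the set does not change.\<close>

lemma weak_sharp_minima_closure:
  assumes "weak_sharp_minima f \<alpha> \<delta> X" "continuous_on UNIV f"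
  shows "weak_sharp_minima f \<alpha> \<delta> (closure X)"
proof -
  have "closure X \<subseteq> sphere 0 1"
    using assms(1) by (intro closure_minimal) (auto simp: weak_sharp_minima_def)
  moreover have "f x - f z \<ge> \<alpha> * infdist x (closure X)"
    if "x \<in> sphere 0 1" "infdist x (closure X) \<le> \<delta>" "z \<in> closure X" for x z
  proof -
    have "closed {z. f x - f z \<ge> \<alpha> * infdist x X}"
      by (intro closed_Collect_le continuous_intros assms(2))
    moreover have "X \<subseteq> {z. f x - f z \<ge> \<alpha> * infdist x X}"
      using assms(1) that by (auto simp: weak_sharp_minima_def infdist_closure)
    ultimately have "closure X \<subseteq> {z. f x - f z \<ge> \<alpha> * infdist x X}"
      by (rule closure_minimal [rotated])
    then show ?thesis
      using that by (auto simp: infdist_closure)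
  qed
  ultimately show ?thesis
    using assms(1) unfolding weak_sharp_minima_def by auto
qed

section \<open>The proximal subproblem\<close>

lemma nonneg_of_small_perturbation:
  fixes a b :: real
  assumes "\<And>s. 0 < s \<Longrightarrow> s < 1 \<Longrightarrow> 0 \<le> a + s * b"
  shows "0 \<le> a"
proof (rule tendsto_lowerbound)
  show "((\<lambda>s. a + s * b) \<longlongrightarrow> a) (at_right 0)"
    by (auto intro!: tendsto_eq_intros)
  show "eventually (\<lambda>s. 0 \<le> a + s * b) (at_right 0)"
    unfolding eventually_at_right_field using assms by (intro exI [of _ 1]) auto
qed simp

text \<open>This is strong convexity of the subproblem at its minimiser, scaled by
  \<open>2 * t\<close>. The minimiser \<open>d\<close> is compared with
  \<open>d + s *\<^sub>R (e - d)\<close>; dividing by \<open>s\<close> and letting \<open>s\<close>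
  tend to 0 leaves the first-order condition.\<close>

lemma prox_inequality:
  fixes f :: "'a::real_inner \<Rightarrow> real"
  assumes convex: "convex_on UNIV f" and "t > 0"
    and min: "is_arg_min (\<lambda>d. f (x + d) + 1 / (2 * t) * (norm d)\<^sup>2) (\<lambda>d. d \<bullet> v = 0) d"
    and "e \<bullet> v = 0"
  shows "2 * t * f (x + d) + (norm d)\<^sup>2 + (norm (e - d))\<^sup>2 \<le> 2 * t * f (x + e) + (norm e)\<^sup>2"
proof -
  have "d \<bullet> v = 0"
    using min by (simp add: is_arg_min_def)
  have "0 \<le> (2 * t * (f (x + e) - f (x + d)) + 2 * (d \<bullet> (e - d))) + s * (norm (e - d))\<^sup>2"
    if s: "0 < s" "s < 1" for s
  proof -
    define c where "c = d + s *\<^sub>R (e - d)"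
    have "c \<bullet> v = 0"
      using \<open>d \<bullet> v = 0\<close> \<open>e \<bullet> v = 0\<close> by (simp add: c_def inner_simps)
    then have "f (x + d) + 1 / (2 * t) * (norm d)\<^sup>2 \<le> f (x + c) + 1 / (2 * t) * (norm c)\<^sup>2"
      using min by (auto simp: is_arg_min_linorder)
    then have "2 * t * (f (x + d) + 1 / (2 * t) * (norm d)\<^sup>2)
        \<le> 2 * t * (f (x + c) + 1 / (2 * t) * (norm c)\<^sup>2)"
      using \<open>t > 0\<close> by (intro mult_left_mono) auto
    then have "2 * t * f (x + d) + (norm d)\<^sup>2 \<le> 2 * t * f (x + c) + (norm c)\<^sup>2"
      using \<open>t > 0\<close> by (simp add: distrib_left)
    moreover have "f (x + c) \<le> (1 - s) * f (x + d) + s * f (x + e)"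
    proof -
      have "x + c = (1 - s) *\<^sub>R (x + d) + s *\<^sub>R (x + e)"
        by (simp add: c_def algebra_simps)
      then show ?thesis
        using convex_onD [OF convex, of s "x + d" "x + e"] s by simp
    qed
    then have "2 * t * f (x + c) \<le> 2 * t * ((1 - s) * f (x + d) + s * f (x + e))"
      using \<open>t > 0\<close> by simp
    moreover have "(norm c)\<^sup>2 = (norm d)\<^sup>2 + s * (2 * (d \<bullet> (e - d))) + s * (s * (norm (e - d))\<^sup>2)"
      unfolding c_def power2_norm_eq_inner
      by (simp add: inner_add inner_commute algebra_simps)
    ultimately have "0 \<le> s * ((2 * t * (f (x + e) - f (x + d)) + 2 * (d \<bullet> (e - d)))
        + s * (norm (e - d))\<^sup>2)"
      by (simp add: algebra_simps)
    then show ?thesis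
      using s by (simp add: zero_le_mult_iff)
  qed
  then have "0 \<le> 2 * t * (f (x + e) - f (x + d)) + 2 * (d \<bullet> (e - d))"
    by (rule nonneg_of_small_perturbation)
  moreover have "(norm e)\<^sup>2 = (norm d)\<^sup>2 + 2 * (d \<bullet> (e - d)) + (norm (e - d))\<^sup>2"
    by (simp add: power2_norm_eq_inner inner_diff inner_commute)
  ultimately show ?thesis
    by (simp add: algebra_simps)
qed

lemma manppa_direction_inequality:
  assumes "manppa_direction Y t x d" "t > 0" "e \<bullet> x = 0"
  shows "2 * t * l1_objective Y (x + d) + (norm d)\<^sup>2 + (norm (e - d))\<^sup>2
    \<le> 2 * t * l1_objective Y (x + e) + (norm e)\<^sup>2"
  using assms prox_inequality [OF convex_on_l1_objective]
  by (simp add: manppa_direction_def l1_objective_def)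

section \<open>One step of the algorithm\<close>

lemma norm_add_tangent_ge:
  fixes x d :: "'a::real_inner"
  assumes "d \<bullet> x = 0"
  shows "norm x \<le> norm (x + d)"
  using assms by (simp add: norm_le inner_add inner_commute)

text \<open>The proximal inequality at \<open>e = 0\<close> yields a decrease of
  \<open>(norm d)\<^sup>2 / t\<close>, twice what the line search asks for, and normalising does not
  increase the objective. So exponent 0 is accepted, and minimality forces
  \<open>j = 0\<close>.\<close>

lemma manppa_step_unit:
  assumes step: "manppa_step Y \<beta> t x x'" and "t > 0" and "norm x = 1"
  obtains d where "manppa_direction Y t x d" "d \<bullet> x = 0" "x' = proj_sphere (x + d)"
proof -
  obtain d j where d: "manppa_direction Y t x d"
    and j: "\<forall>i<j. \<not> manppa_accept Y \<beta> t x d i" "x' = proj_sphere (x + \<beta> ^ j *\<^sub>R d)"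
    using step by (auto simp: manppa_step_def)
  have tan: "d \<bullet> x = 0"
    using d by (simp add: manppa_direction_def is_arg_min_def)
  have "l1_objective Y (proj_sphere (x + d)) \<le> l1_objective Y (x + d)"
    using norm_add_tangent_ge [OF tan] \<open>norm x = 1\<close> by (intro l1_objective_proj_sphere_le) simp
  moreover have "2 * t * l1_objective Y (x + d) + 2 * (norm d)\<^sup>2 \<le> 2 * t * l1_objective Y x"
    using manppa_direction_inequality [OF d \<open>t > 0\<close>, of 0] by simp
  then have "2 * t * l1_objective Y (x + d) + (norm d)\<^sup>2 \<le> 2 * t * l1_objective Y x"
    using zero_le_power2 [of "norm d"] by linarith
  then have "l1_objective Y (x + d) \<le> l1_objective Y x - 1 / (2 * t) * (norm d)\<^sup>2"
    using \<open>t > 0\<close> by (simp add: field_simps)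
  ultimately have "manppa_accept Y \<beta> t x d 0"
    by (simp add: manppa_accept_def)
  then have "j = 0"
    using j(1) by blast
  then show thesis
    using that d tan j(2) by simp
qed

lemma convex_quadratic_le_on_interval:
  fixes a b c r s m :: real
  assumes "0 \<le> a" "0 \<le> r" "r \<le> s" "c \<le> m" "a * s\<^sup>2 + b * s + c \<le> m"
  shows "a * r\<^sup>2 + b * r + c \<le> m"
proof (cases "s = 0")
  case True
  then show ?thesis using assms by simp
next
  case False
  then have "0 < s" using assms by simp
  \<comment> \<open>The chord between the end points 0 and \<open>s\<close>, minus the convexity
    gap, all multiplied by \<open>s\<close>.\<close>
  have "s * (a * r\<^sup>2 + b * r + c) = r * (a * s\<^sup>2 + b * s + c) + (s - r) * c - a * (r * (s * (s - r)))"
    by (simp add: power2_eq_square algebra_simps)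
  also have "\<dots> \<le> r * m + (s - r) * m - 0"
    using assms \<open>0 < s\<close> by (intro diff_mono add_mono mult_left_mono) auto
  also have "\<dots> = s * m"
    by (simp add: algebra_simps)
  finally show ?thesis
    using \<open>0 < s\<close> by simp
qed

text \<open>Here \<open>z\<close> is any unit vector. Sharpness is inserted only afterwards: at
  \<open>x'\<close> for the rate, at \<open>x\<close> for the descent.\<close>

lemma manppa_step_estimates:
  assumes lip: "L-lipschitz_on UNIV (l1_objective Y)" and "t > 0"
    and "norm x = 1" "norm z = 1" and step: "manppa_step Y \<beta> t x x'"
  shows "2 * t * (l1_objective Y x' - l1_objective Y z) \<le> (1 + t * L) * (norm (x - z))\<^sup>2" (is ?rate)
    and "(norm (x' - z))\<^sup>2 \<le> (1 + t * L) * (norm (x - z))\<^sup>2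
      - 2 * t * (l1_objective Y x - l1_objective Y z) + (t * L)\<^sup>2" (is ?descent)
proof -
  obtain d where d: "manppa_direction Y t x d" and tan: "d \<bullet> x = 0" and x': "x' = proj_sphere (x + d)"
    using manppa_step_unit [OF step \<open>t > 0\<close> \<open>norm x = 1\<close>] .
  define f where "f = l1_objective Y"
  define r where "r = norm (x - z)"
  define e where "e = z - (z \<bullet> x) *\<^sub>R x"
  have unit: "x \<bullet> x = 1" "z \<bullet> z = 1"
    using assms by (simp_all add: norm_eq_1)
  have zx: "z \<bullet> x = 1 - r\<^sup>2 / 2"
    by (simp add: r_def power2_norm_eq_inner inner_diff inner_commute unit field_simps)
  have ex: "e \<bullet> x = 0"
    by (simp add: e_def inner_diff unit)
  have xe: "x + e = z + (r\<^sup>2 / 2) *\<^sub>R x"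
    by (simp add: e_def zx algebra_simps)
  have ne: "(norm e)\<^sup>2 = r\<^sup>2 - (r\<^sup>2 / 2)\<^sup>2"
  proof -
    have "(norm e)\<^sup>2 = 1 - (z \<bullet> x)\<^sup>2"
      unfolding e_def power2_norm_eq_inner
      by (simp add: inner_diff inner_commute unit power2_eq_square)
    also have "\<dots> = r\<^sup>2 - (r\<^sup>2 / 2)\<^sup>2"
      by (simp add: zx power2_eq_square algebra_simps)
    finally show ?thesis .
  qed
  have lip': "f u - f v \<le> L * norm (u - v)" for u v
    using lipschitz_onD [OF lip, of u v] by (simp add: f_def dist_norm)
  have "f (x + e) - f z \<le> L * (r\<^sup>2 / 2)"
    using lip' [of "x + e" z] \<open>norm x = 1\<close> by (simp add: xe)
  then have "2 * t * (f (x + e) - f z) \<le> 2 * t * (L * (r\<^sup>2 / 2))"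
    using \<open>t > 0\<close> by simp
  moreover have "2 * t * f (x + d) + (norm d)\<^sup>2 + (norm (e - d))\<^sup>2 \<le> 2 * t * f (x + e) + (norm e)\<^sup>2"
    unfolding f_def by (rule manppa_direction_inequality [OF d \<open>t > 0\<close> ex])
  \<comment> \<open>The term \<open>(r\<^sup>2 / 2)\<^sup>2\<close> is kept because it cancels the
    normal part of \<open>x + d - z\<close> in the descent bound.\<close>
  ultimately have main: "2 * t * (f (x + d) - f z) + (norm d)\<^sup>2 + (norm (e - d))\<^sup>2 + (r\<^sup>2 / 2)\<^sup>2
      \<le> (1 + t * L) * r\<^sup>2"
    using ne by (simp add: algebra_simps)
  have ge1: "1 \<le> norm (x + d)"
    using norm_add_tangent_ge [OF tan] \<open>norm x = 1\<close> by simp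
  have "f x' \<le> f (x + d)"
    unfolding f_def x' by (rule l1_objective_proj_sphere_le [OF ge1])
  then have "2 * t * (f x' - f z) \<le> 2 * t * (f (x + d) - f z)"
    using \<open>t > 0\<close> by simp
  also have "\<dots> \<le> (1 + t * L) * r\<^sup>2"
    using main zero_le_power2 [of "norm d"] zero_le_power2 [of "norm (e - d)"]
      zero_le_power2 [of "r\<^sup>2 / 2"] by linarith
  finally show ?rate
    by (simp add: f_def r_def)
  have "(norm (x' - z))\<^sup>2 \<le> (norm (x + d - z))\<^sup>2"
    unfolding x' using norm_proj_sphere_diff_le [OF ge1 \<open>norm z = 1\<close>] by simp
  also have "x + d - z = (d - e) + (r\<^sup>2 / 2) *\<^sub>R x"
    using xe by (simp add: algebra_simps)
  \<comment> \<open>\<open>d - e\<close> is tangent at \<open>x\<close>, hence orthogonal to the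
    multiple of \<open>x\<close>.\<close>
  also have "(norm ((d - e) + (r\<^sup>2 / 2) *\<^sub>R x))\<^sup>2 = (norm (e - d))\<^sup>2 + (r\<^sup>2 / 2)\<^sup>2"
    using tan ex \<open>norm x = 1\<close>
    by (subst norm_add_Pythagorean) (simp_all add: orthogonal_def inner_diff norm_minus_commute)
  also have "\<dots> \<le> (1 + t * L) * r\<^sup>2 - 2 * t * (f x - f z) + (2 * t * (f x - f (x + d)) - (norm d)\<^sup>2)"
    using main by (simp add: algebra_simps)
  \<comment> \<open>The Lipschitz bound leaves \<open>2 * t * L * norm d - (norm d)\<^sup>2\<close>;
    complete the square.\<close>
  also have "2 * t * (f x - f (x + d)) - (norm d)\<^sup>2 \<le> (t * L)\<^sup>2"
  proof -
    have "2 * t * (f x - f (x + d)) \<le> 2 * t * (L * norm d)"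
      using lip' [of x "x + d"] \<open>t > 0\<close> by simp
    then show ?thesis
      using zero_le_power2 [of "t * L - norm d"] by (simp add: power2_diff algebra_simps)
  qed
  finally show ?descent
    by (simp add: f_def r_def)
qed

section \<open>Invariance of the neighbourhood and the quadratic rate\<close>

theorem theorem2p4:
  fixes Y :: "real^'p^'n"
    and X :: "(real^'n) set"
    and x :: "nat \<Rightarrow> real^'n"
    and L \<alpha> \<delta> \<delta>bar \<beta> t :: real
  assumes "L > 0" and "L-lipschitz_on UNIV (l1_objective Y)"
    and "\<alpha> > 0" and "\<delta> > 0"
    and "weak_sharp_minima (l1_objective Y) \<alpha> \<delta> X"
    and "\<delta>bar = min \<delta> (\<alpha> / L)"
    and "0 < \<beta>" and "\<beta> < 1"
    and "t > 0"
    and "t \<le> min (\<delta>bar / (2 * \<alpha> - L * \<delta>bar)) ((2 * \<delta>bar * \<alpha> - L * \<delta>bar\<^sup>2) / L\<^sup>2)"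
    and "x 0 \<in> sphere 0 1"
    and "infdist (x 0) X < \<delta>bar"
    and "manppa_sequence Y \<beta> t x"
  shows "(\<forall>k. infdist (x k) X \<le> \<delta>bar) \<and>
         (\<exists>C>0. \<forall>k. infdist (x (Suc k)) X \<le> C * (infdist (x k) X)\<^sup>2)"
proof -
  define f where "f = l1_objective Y"
  define Z where "Z = closure X"
  have cont: "continuous_on UNIV f"
    unfolding f_def using assms(2) by (rule lipschitz_on_continuous_on)
  have wsZ: "weak_sharp_minima f \<alpha> \<delta> Z"
    unfolding Z_def using assms(5) cont by (intro weak_sharp_minima_closure) (simp_all add: f_def)
  then have Z: "Z \<noteq> {}" "Z \<subseteq> sphere 0 1"
    by (simp_all add: weak_sharp_minima_def)
  have sharp: "\<alpha> * infdist u Z \<le> f u - f z"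
    if "norm u = 1" "infdist u Z \<le> \<delta>" "z \<in> Z" for u z
    using wsZ that by (simp add: weak_sharp_minima_def)
  have db: "0 < \<delta>bar" "\<delta>bar \<le> \<delta>" "L * \<delta>bar \<le> \<alpha>"
    using assms(1,3,4,6) by (auto simp: min_def field_simps)
  \<comment> \<open>The denominator is positive: \<open>L * \<delta>bar \<le> \<alpha>\<close> makes
    it at least \<alpha>.\<close>
  have t1: "t * (2 * \<alpha> - L * \<delta>bar) \<le> \<delta>bar"
    using assms(3,10) db by (simp add: pos_le_divide_eq)
  have t2: "t * L\<^sup>2 \<le> \<delta>bar * (2 * \<alpha> - L * \<delta>bar)"
    using assms(1,10) by (simp add: pos_le_divide_eq power2_eq_square algebra_simps)
  \<comment> \<open>The end point 0 of the quadratic; both bounds on \<open>t\<close> are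
    chained.\<close>
  have tL: "(t * L)\<^sup>2 \<le> \<delta>bar\<^sup>2"
  proof -
    have "(t * L)\<^sup>2 = t * (t * L\<^sup>2)"
      by (simp add: power2_eq_square)
    also have "\<dots> \<le> t * (\<delta>bar * (2 * \<alpha> - L * \<delta>bar))"
      using t2 assms(9) by simp
    also have "\<dots> = \<delta>bar * (t * (2 * \<alpha> - L * \<delta>bar))"
      by simp
    also have "\<dots> \<le> \<delta>bar * \<delta>bar"
      using t1 db by simp
    finally show ?thesis
      by (simp add: power2_eq_square)
  qed
  \<comment> \<open>The end point \<open>\<delta>bar\<close>: this is \<open>t2\<close> multiplied
    by \<open>t\<close>.\<close>
  have end_point: "(1 + t * L) * \<delta>bar\<^sup>2 + (- 2 * t * \<alpha>) * \<delta>bar + (t * L)\<^sup>2 \<le> \<delta>bar\<^sup>2"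
    using mult_left_mono [OF t2, of t] assms(9) by (simp add: power2_eq_square algebra_simps)
  have next_le: "infdist u' Z \<le> \<delta>bar"
    and next_rate: "2 * t * (\<alpha> * infdist u' Z) \<le> (1 + t * L) * (infdist u Z)\<^sup>2"
    if u: "norm u = 1" "infdist u Z \<le> \<delta>bar" and step: "manppa_step Y \<beta> t u u'" for u u'
  proof -
    obtain z where z: "z \<in> Z" "infdist u Z = norm (u - z)"
      using infdist_attains_inf [of Z u] Z(1) by (auto simp: Z_def dist_norm)
    have "norm z = 1"
      using z(1) Z(2) by auto
    note est = manppa_step_estimates [OF assms(2) assms(9) u(1) \<open>norm z = 1\<close> step,
        folded f_def z(2)]
    have "\<alpha> * infdist u Z \<le> f u - f z"
      using sharp u z(1) db by simp
    then have "2 * t * (\<alpha> * infdist u Z) \<le> 2 * t * (f u - f z)"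
      using assms(9) by simp
    then have "(norm (u' - z))\<^sup>2
        \<le> (1 + t * L) * (infdist u Z)\<^sup>2 + (- 2 * t * \<alpha>) * infdist u Z + (t * L)\<^sup>2"
      using est(2) by (simp add: algebra_simps)
    also have "\<dots> \<le> \<delta>bar\<^sup>2"
      by (rule convex_quadratic_le_on_interval [OF _ infdist_nonneg u(2) tL end_point])
        (use assms(1,9) in simp)
    finally have "norm (u' - z) \<le> \<delta>bar"
      by (rule power2_le_imp_le) (use db in auto)
    then show le: "infdist u' Z \<le> \<delta>bar"
      using infdist_le2 [OF z(1), of u'] by (simp add: dist_norm)
    \<comment> \<open>Sharpness at \<open>u'\<close> becomes available only through
      \<open>le\<close>, which places \<open>u'\<close> within \<delta> of \<open>Z\<close>.\<close>
    have "norm u' = 1"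
      using step proj_sphere_in_sphere by (auto simp: manppa_step_def)
    then have "\<alpha> * infdist u' Z \<le> f u' - f z"
      using sharp le z(1) db by simp
    then have "2 * t * (\<alpha> * infdist u' Z) \<le> 2 * t * (f u' - f z)"
      using assms(9) by simp
    then show "2 * t * (\<alpha> * infdist u' Z) \<le> (1 + t * L) * (infdist u Z)\<^sup>2"
      using est(1) by linarith
  qed
  have step: "manppa_step Y \<beta> t (x k) (x (Suc k))" for k
    using assms(13) by (simp add: manppa_sequence_def)
  have inv: "norm (x k) = 1 \<and> infdist (x k) Z \<le> \<delta>bar" for k
  proof (induction k)
    case 0
    then show ?case
      using assms(11,12) by (simp add: Z_def infdist_closure)
  next
    case (Suc k)
    moreover have "norm (x (Suc k)) = 1"
      using step [of k] proj_sphere_in_sphere by (auto simp: manppa_step_def)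
    ultimately show ?case
      using next_le step by blast
  qed
  \<comment> \<open>The constant comes from dividing \<open>next_rate\<close> by
    \<open>2 * t * \<alpha>\<close>.\<close>
  have "infdist (x (Suc k)) Z \<le> (1 + t * L) / (2 * t * \<alpha>) * (infdist (x k) Z)\<^sup>2" for k
    using next_rate [OF _ _ step] inv assms(3,9) by (simp add: field_simps)
  moreover have "(1 + t * L) / (2 * t * \<alpha>) > 0"
    using assms(1,3,9) by (simp add: add_pos_pos)
  ultimately show ?thesis
    using inv unfolding Z_def infdist_closure by blast
qed

end
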